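(* For every $q\in\mathbb{Q}\setminus\{\pm1\}$, let $\Phi_q$ be the plane cubic curve in the coordinates $(\rho,u)$ given by \[ \Phi_q:\quad u^{3}-(1-\rho^{2})\,u-\frac{2(1-\rho)^{2}(\rho-q)(1+q)}{1-q}=0 . \] Then the point $(\rho,u)=(1,0)$ is a node of $\Phi_q$. Moreover, the rational points of $\Phi_q$ other than the node are parametrized by \[ \rho=\rho(t,q)=\frac{q(q+1)+(1-q)(4t^{3}-t)}{(q+1)+(1-q)(4t^{3}+t)},\qquad u=2t(1-\rho), \] for $t\in\mathbb{Q}$ with $(q+1)+(1-q)(4t^3+t)\neq0$; that is, every rational point $(\rho,u)\neq(1,0)$ of $\Phi_q$ is of this form for a unique such $t$.
   Context: A node of a plane curve is a singular point of multiplicity $2$ with two distinct tangent directions. The curve $\Phi_q$ is considered as an affine plane curve over $\mathbb{Q}$ in the coordinates $(\rho,u)$, with $q$ a fixed rational parameter.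
   Formalization: For q=0 the printed claim fails: the cubic contains the line u=ρ−1, whose points other than the node would need t=−1/2, where the denominator vanishes. The parametrization claim therefore excludes the points with q=0 and u=ρ−1. *)

theory Defs
  imports Complex_Main "HOL-Computational_Algebra.Polynomial"
begin

text \<open>
  Polynomials in two variables \<open>\<rho>, u\<close> over \<open>'a\<close> are elements of \<open>'a poly poly\<close>: the outer
  variable is \<open>u\<close>, and the coefficients are polynomials in \<open>\<rho>\<close>.  Points are pairs \<open>(\<rho>, u)\<close>.
\<close>

abbreviation var_rho :: "'a::comm_ring_1 poly poly" where
  "var_rho \<equiv> [:[:0, 1:]:]"

abbreviation var_u :: "'a::comm_ring_1 poly poly" where
  "var_u \<equiv> [:0, 1:]"

abbreviation scalar :: "'a::comm_ring_1 \<Rightarrow> 'a poly poly" where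
  "scalar c \<equiv> [:[:c:]:]"

definition eval2 :: "'a::comm_ring_1 poly poly \<Rightarrow> 'a \<times> 'a \<Rightarrow> 'a" where
  "eval2 f P = poly (poly f [:snd P:]) (fst P)"

definition affine_curve :: "'a::comm_ring_1 poly poly \<Rightarrow> ('a \<times> 'a) set" where
  "affine_curve f = {P. eval2 f P = 0}"

definition singular_point :: "'a::idom poly poly \<Rightarrow> 'a \<times> 'a \<Rightarrow> bool" where
  "singular_point f P \<longleftrightarrow>
     eval2 f P = 0 \<and> eval2 (map_poly pderiv f) P = 0 \<and> eval2 (pderiv f) P = 0"

text \<open>The polynomial \<open>f (a + \<rho>, b + u)\<close> for \<open>P = (a, b)\<close>, i.e. \<open>f\<close> with \<open>P\<close> moved to the origin.\<close>

definition translate :: "'a::comm_ring_1 poly poly \<Rightarrow> 'a \<times> 'a \<Rightarrow> 'a poly poly" where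
  "translate f P =
     pcompose (map_poly (\<lambda>c. pcompose c [:fst P, 1:]) f) [:[:snd P:], 1:]"

definition local_coeff :: "'a::comm_ring_1 poly poly \<Rightarrow> 'a \<times> 'a \<Rightarrow> nat \<Rightarrow> nat \<Rightarrow> 'a" where
  "local_coeff f P i j = coeff (coeff (translate f P) j) i"

text \<open>The lowest degree occurring in \<open>translate f P\<close>; meaningful for \<open>f \<noteq> 0\<close> only.\<close>

definition point_multiplicity :: "'a::comm_ring_1 poly poly \<Rightarrow> 'a \<times> 'a \<Rightarrow> nat" where
  "point_multiplicity f P = (LEAST m. \<exists>i j. i + j = m \<and> local_coeff f P i j \<noteq> 0)"

text \<open>
  The leading form of \<open>f\<close> at \<open>P\<close>, evaluated over the algebraically closed field of complex
  numbers, so that tangent directions are geometric and not only those defined over the rationals.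
\<close>

definition tangent_form :: "rat poly poly \<Rightarrow> rat \<times> rat \<Rightarrow> complex \<Rightarrow> complex \<Rightarrow> complex" where
  "tangent_form f P X Y =
     (let m = point_multiplicity f P
      in \<Sum>i\<le>m. of_rat (local_coeff f P i (m - i)) * X ^ i * Y ^ (m - i))"

text \<open>A direction is the line through the origin spanned by a nonzero vector.\<close>

definition tangent_directions :: "rat poly poly \<Rightarrow> rat \<times> rat \<Rightarrow> (complex \<times> complex) set set" where
  "tangent_directions f P =
     {range (\<lambda>s. (s * X, s * Y)) | X Y. (X, Y) \<noteq> (0, 0) \<and> tangent_form f P X Y = 0}"

definition is_node :: "rat poly poly \<Rightarrow> rat \<times> rat \<Rightarrow> bool" where
  "is_node f P \<longleftrightarrow>
     singular_point f P \<and> point_multiplicity f P = 2 \<and> card (tangent_directions f P) = 2"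

definition Phi :: "rat \<Rightarrow> rat poly poly" where
  "Phi q = var_u ^ 3 - (1 - var_rho ^ 2) * var_u
     - 2 * (1 - var_rho) ^ 2 * (var_rho - scalar q) * scalar ((1 + q) / (1 - q))"

definition param_num :: "rat \<Rightarrow> rat \<Rightarrow> rat" where
  "param_num t q = q * (q + 1) + (1 - q) * (4 * t ^ 3 - t)"

definition param_den :: "rat \<Rightarrow> rat \<Rightarrow> rat" where
  "param_den t q = (q + 1) + (1 - q) * (4 * t ^ 3 + t)"

definition param_rho :: "rat \<Rightarrow> rat \<Rightarrow> rat" where
  "param_rho t q = param_num t q / param_den t q"

definition param_u :: "rat \<Rightarrow> rat \<Rightarrow> rat" where
  "param_u t q = 2 * t * (1 - param_rho t q)"

lemma eval2_Phi:
  "eval2 (Phi q) (r, u) =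
     u ^ 3 - (1 - r ^ 2) * u - 2 * (1 - r) ^ 2 * (r - q) * (1 + q) / (1 - q)"
  by (simp add: eval2_def Phi_def algebra_simps flip: add_divide_distrib diff_divide_distrib)

text \<open>
  \<open>Phi 0\<close> is reducible: it contains the line \<open>u = \<rho> - 1\<close>, whose slope corresponds to the parameter
  \<open>t = - 1 / 2\<close>, where \<open>param_den t 0\<close> vanishes.  Hence the rational points of that line other
  than the node are not parametrized.
\<close>

lemma Phi_0_contains_line: "(r, r - 1) \<in> affine_curve (Phi 0)"
  by (simp add: affine_curve_def eval2_Phi power2_eq_square power3_eq_cube algebra_simps)

lemma Phi_0_line_not_parametrized:
  assumes "r \<noteq> 1"
  shows "\<not> (\<exists>t. param_den t 0 \<noteq> 0 \<and> r = param_rho t 0 \<and> r - 1 = param_u t 0)"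
proof
  assume "\<exists>t. param_den t 0 \<noteq> 0 \<and> r = param_rho t 0 \<and> r - 1 = param_u t 0"
  then obtain t where d: "param_den t 0 \<noteq> 0" and "r - 1 = 2 * t * (1 - r)"
    by (auto simp: param_u_def)
  then have "(1 - r) * (2 * t + 1) = 0" by (simp add: algebra_simps)
  with assms have "2 * t + 1 = 0" by simp
  then have "t = - 1 / 2" by linarith
  with d show False by (simp add: param_den_def power3_eq_cube)
qed

end

theory Submission
  imports Defs
begin

text \<open>
  Put \<open>s = \<rho> - 1\<close> and \<open>k = (1 + q) / (1 - q)\<close>.  Moving the point \<open>(1, 0)\<close> to the origin turns
  the cubic into
  \<open>(2 s u - 2 (1 + q) s\<^sup>2) + (u ^ 3 + s\<^sup>2 u - 2 k s ^ 3)\<close>.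
  It has no terms of degree below two, and its leading form \<open>2 s (u - (1 + q) s)\<close> is a product of
  two linear forms that are never proportional.  So \<open>(1, 0)\<close> is a node, with the vertical tangent
  and the tangent of slope \<open>1 + q\<close> (\<open>translate_Phi\<close>, \<open>is_node_Phi\<close>).

  The parametrization is the projection of the cubic from this double point.  A line \<open>u = - 2 t s\<close>
  meets the cubic twice at the node, and after the factor \<open>s\<^sup>2\<close> is removed the remaining condition
  is linear in \<open>s\<close>: with \<open>D = param_den t q\<close> it reads \<open>s D = - (1 - q) (2 t + 1 + q)\<close>
  (\<open>Phi_on_line\<close>, \<open>param_num_minus_den\<close>).  If \<open>D \<noteq> 0\<close> there is exactly one solution, namely
  \<open>param_rho t q - 1\<close>.  The vertical line \<open>s = 0\<close> meets the curve in the node only, so every other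
  point lies on exactly one of the lines \<open>u = - 2 t s\<close>.

  What is left is \<open>D = 0\<close>.  A line with \<open>D = 0\<close> that carries a further point of the curve has
  \<open>2 t = - (1 + q)\<close>, i.e. it is the tangent of slope \<open>1 + q\<close>, and it is then contained in the
  cubic.  For this slope \<open>D = q\<^sup>2 (1 + q)\<^sup>2 / 2\<close> (\<open>param_den_tangent\<close>), which vanishes for
  \<open>q = 0\<close> only; the line in question is \<open>u = \<rho> - 1\<close>, a component of the cubic for \<open>q = 0\<close>.
\<close>

lemma Phi_coeffs:
  "Phi q = [:[:2 * q * ((1 + q) / (1 - q)), - 2 * (1 + 2 * q) * ((1 + q) / (1 - q)),
               2 * (2 + q) * ((1 + q) / (1 - q)), - 2 * ((1 + q) / (1 - q)):],
             [:- 1, 0, 1:], 0, 1:]"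
proof -
  define k where "k = (1 + q) / (1 - q)"
  show ?thesis
    unfolding Phi_def k_def[symmetric]
    by (simp add: power2_eq_square power3_eq_cube one_pCons numeral_poly algebra_simps)
qed

lemma translate_Phi:
  assumes "q \<noteq> 1"
  shows "translate (Phi q) (1, 0) =
    [:[:0, 0, - 2 * (1 + q), - 2 * ((1 + q) / (1 - q)):], [:0, 2, 1:], 0, 1:]"
proof -
  define k where "k = (1 + q) / (1 - q)"
  \<comment> \<open>Linear in \<open>k\<close>, this relation lets the division be forgotten.\<close>
  have k: "1 + q = k * (1 - q)"
    using assms by (simp add: k_def)
  show ?thesis
    unfolding translate_def Phi_coeffs k_def[symmetric]
    unfolding k
    by (simp add: map_poly_pCons pcompose_pCons one_pCons algebra_simps)
qed

lemma local_coeff_Phi: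
  assumes "q \<noteq> 1"
  shows "local_coeff (Phi q) (1, 0) i j =
    (if (i, j) = (2, 0) then - 2 * (1 + q)
     else if (i, j) = (3, 0) then - 2 * ((1 + q) / (1 - q))
     else if (i, j) = (1, 1) then 2
     else if (i, j) = (2, 1) then 1
     else if (i, j) = (0, 3) then 1 else 0)"
  unfolding local_coeff_def translate_Phi[OF assms]
  by (auto simp: coeff_pCons numeral_eq_Suc split: nat.splits)

lemma singular_point_Phi: "singular_point (Phi q) (1, 0)"
proof -
  define k where "k = (1 + q) / (1 - q)"
  show ?thesis
    unfolding singular_point_def Phi_coeffs k_def[symmetric]
    by (simp add: eval2_def map_poly_pCons pderiv_pCons algebra_simps)
qed

text \<open>The mixed term \<open>2 s u\<close> makes the multiplicity two for every \<open>q\<close>.\<close>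

lemma point_multiplicity_Phi:
  assumes "q \<noteq> 1"
  shows "point_multiplicity (Phi q) (1, 0) = 2"
  unfolding point_multiplicity_def
proof (rule Least_equality)
  show "\<exists>i j. i + j = 2 \<and> local_coeff (Phi q) (1, 0) i j \<noteq> 0"
    by (rule exI[of _ 1], rule exI[of _ 1]) (simp add: local_coeff_Phi[OF assms])
next
  fix m assume "\<exists>i j. i + j = m \<and> local_coeff (Phi q) (1, 0) i j \<noteq> 0"
  then show "2 \<le> m"
    by (auto simp: local_coeff_Phi[OF assms] split: if_splits)
qed

lemma tangent_form_Phi:
  assumes "q \<noteq> 1"
  shows "tangent_form (Phi q) (1, 0) X Y = 2 * X * (Y - of_rat (1 + q) * X)"
proof -
  have "{..2::nat} = {0, 1, 2}" by auto
  then show ?thesis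
    by (simp add: tangent_form_def point_multiplicity_Phi[OF assms] local_coeff_Phi[OF assms]
        of_rat_mult of_rat_minus of_rat_add of_rat_diff power2_eq_square algebra_simps)
qed

text \<open>
  A nonzero vector on which \<open>X (Y - (1 + q) X)\<close> vanishes is a multiple of \<open>(0, 1)\<close> or of
  \<open>(1, 1 + q)\<close>.
\<close>

lemma tangent_directions_Phi:
  assumes "q \<noteq> 1"
  shows "tangent_directions (Phi q) (1, 0) =
    {range (\<lambda>s. (0, s)), range (\<lambda>s. (s, s * of_rat (1 + q)))}"
proof -
  define a :: complex where "a = of_rat (1 + q)"
  have scale: "range (\<lambda>s. (s * (c * x), s * (c * y))) = range (\<lambda>s. (s * x, s * y))"
    if "c \<noteq> 0" for c x y :: complex
  proof -
    have "bij (\<lambda>s. s * c)"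
      using that by (intro bij_betw_byWitness[where f' = "\<lambda>s. s / c"]) auto
    then have "range (\<lambda>s. (s * x, s * y)) = (\<lambda>s. (s * x, s * y)) ` range (\<lambda>s. s * c)"
      by (simp add: bij_is_surj)
    then show ?thesis by (simp add: image_image mult.assoc)
  qed
  have vertical: "range (\<lambda>s. (s * 0, s * Y)) = range (\<lambda>s. (0, s))" if "Y \<noteq> 0" for Y :: complex
    using scale[OF that, of 0 1] by simp
  have oblique: "range (\<lambda>s. (s * X, s * (a * X))) = range (\<lambda>s. (s, s * a))"
    if "X \<noteq> 0" for X :: complex
    using scale[OF that, of 1 a] by (simp add: mult.commute)
  have form: "tangent_form (Phi q) (1, 0) X Y = 0 \<longleftrightarrow> X = 0 \<or> Y = a * X" for X Y
    by (auto simp: tangent_form_Phi[OF assms] a_def)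
  show ?thesis
    unfolding tangent_directions_def form a_def[symmetric]
  proof (intro equalityI subsetI)
    fix L assume "L \<in> {range (\<lambda>s. (s * X, s * Y)) |X Y. (X, Y) \<noteq> (0, 0) \<and> (X = 0 \<or> Y = a * X)}"
    then obtain X Y where L: "L = range (\<lambda>s. (s * X, s * Y))"
      and XY: "(X, Y) \<noteq> (0, 0)" "X = 0 \<or> Y = a * X"
      by blast
    show "L \<in> {range (\<lambda>s. (0, s)), range (\<lambda>s. (s, s * a))}"
    proof (cases "X = 0")
      case True
      with XY have "Y \<noteq> 0" by simp
      from vertical[OF this] show ?thesis unfolding L True by blast
    next
      case False
      with XY have "Y = a * X" by blast
      with oblique[OF False] show ?thesis unfolding L by blast
    qed
  next
    fix L assume "L \<in> {range (\<lambda>s. (0, s)), range (\<lambda>s. (s, s * a))}"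
    then consider "L = range (\<lambda>s. (s * 0, s * 1))" | "L = range (\<lambda>s. (s * 1, s * (a * 1)))"
      by auto
    then show "L \<in> {range (\<lambda>s. (s * X, s * Y)) |X Y. (X, Y) \<noteq> (0, 0) \<and> (X = 0 \<or> Y = a * X)}"
    proof cases
      case 1
      show ?thesis
        by (rule CollectI, rule exI[of _ 0], rule exI[of _ 1]) (simp add: 1)
    next
      case 2
      show ?thesis
        by (rule CollectI, rule exI[of _ 1], rule exI[of _ "a * 1"]) (simp add: 2)
    qed
  qed
qed

lemma is_node_Phi:
  assumes "q \<noteq> 1"
  shows "is_node (Phi q) (1, 0)"
proof -
  have "(0, 1) \<in> range (\<lambda>s :: complex. (0 :: complex, s))"
    by blast
  moreover have "(0, 1) \<notin> range (\<lambda>s. (s, s * a))" for a :: complex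
    by auto
  ultimately have "range (\<lambda>s. (0, s)) \<noteq> range (\<lambda>s. (s, s * a))" for a :: complex
    by metis
  then show ?thesis
    by (simp add: is_node_def singular_point_Phi point_multiplicity_Phi[OF assms]
        tangent_directions_Phi[OF assms])
qed

text \<open>
  Restricted to a line through the double point, the cubic is a square times a linear factor.
\<close>

lemma Phi_on_line:
  assumes "q \<noteq> 1"
  shows "eval2 (Phi q) (r, 2 * t * (1 - r)) * (1 - q) =
    2 * (1 - r) ^ 2 * ((1 - r) * param_den t q - (1 - q) * (2 * t + 1 + q))"
proof -
  have "eval2 (Phi q) (r, 2 * t * (1 - r)) * (1 - q) =
    ((2 * t * (1 - r)) ^ 3 - (1 - r ^ 2) * (2 * t * (1 - r))) * (1 - q)
      - 2 * (1 - r) ^ 2 * (r - q) * (1 + q)"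
    using assms by (simp add: eval2_Phi left_diff_distrib)
  also have "\<dots> = 2 * (1 - r) ^ 2 * ((1 - r) * param_den t q - (1 - q) * (2 * t + 1 + q))"
    unfolding param_den_def by algebra
  finally show ?thesis .
qed

lemma param_num_minus_den: "param_num t q - param_den t q = - (1 - q) * (2 * t + 1 + q)"
  unfolding param_num_def param_den_def by algebra

lemma param_rho_eq_iff:
  assumes "param_den t q \<noteq> 0"
  shows "r = param_rho t q \<longleftrightarrow> (1 - r) * param_den t q = (1 - q) * (2 * t + 1 + q)"
proof -
  have "r = param_rho t q \<longleftrightarrow> r * param_den t q = param_num t q"
    using assms by (auto simp: param_rho_def field_simps)
  also have "\<dots> \<longleftrightarrow> (1 - r) * param_den t q = (1 - q) * (2 * t + 1 + q)"
    using param_num_minus_den[of t q] by (simp add: algebra_simps) linarith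
  finally show ?thesis .
qed

lemma param_den_tangent:
  assumes "2 * t + 1 + q = 0"
  shows "2 * param_den t q = q ^ 2 * (1 + q) ^ 2"
proof -
  have "q = - 2 * t - 1" using assms by linarith
  then show ?thesis
    unfolding param_den_def by algebra
qed

lemma param_in_curve:
  assumes "q \<noteq> 1" and "param_den t q \<noteq> 0"
  shows "(param_rho t q, param_u t q) \<in> affine_curve (Phi q)"
proof -
  have "(1 - param_rho t q) * param_den t q = (1 - q) * (2 * t + 1 + q)"
    using param_rho_eq_iff[OF assms(2)] by blast
  with Phi_on_line[OF assms(1), of "param_rho t q" t] assms(1) show ?thesis
    by (simp add: affine_curve_def param_u_def)
qed

lemma curve_point_on_vertical:
  assumes "(1, u) \<in> affine_curve (Phi q)"
  shows "u = 0"
  using assms by (simp add: affine_curve_def eval2_Phi)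

lemma param_exists:
  assumes "q \<noteq> 1" and "q \<noteq> - 1" and "(r, u) \<in> affine_curve (Phi q)" and "r \<noteq> 1"
    and "\<not> (q = 0 \<and> u = r - 1)"
  shows "\<exists>t. param_den t q \<noteq> 0 \<and> r = param_rho t q \<and> u = param_u t q"
proof -
  define t where "t = u / (1 - r) / 2"
  have "2 * (x / 2) = x" for x :: rat
    by simp
  then have "2 * t = u / (1 - r)"
    unfolding t_def .
  then have u: "u = 2 * t * (1 - r)"
    using assms(4) by simp
  have lin: "(1 - r) * param_den t q = (1 - q) * (2 * t + 1 + q)"
    using Phi_on_line[OF assms(1), of r t] assms(3,4) by (simp add: affine_curve_def u)
  have den: "param_den t q \<noteq> 0"
  proof
    assume D: "param_den t q = 0"
    with lin assms(1) have slope: "2 * t + 1 + q = 0"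
      by simp
    from param_den_tangent[OF this] D assms(2) have "q = 0"
      by (auto simp: add_eq_0_iff2)
    moreover from this slope have "2 * t = - 1" by simp
    ultimately show False
      using assms(5) u by simp
  qed
  have r: "r = param_rho t q"
    using param_rho_eq_iff[OF den] lin by blast
  moreover from r u have "u = param_u t q"
    by (simp add: param_u_def)
  ultimately show ?thesis using den by blast
qed

lemma param_unique:
  assumes "r \<noteq> 1" and "r = param_rho t q" "u = param_u t q"
    and "r = param_rho t' q" "u = param_u t' q"
  shows "t = t'"
proof -
  have "2 * t * (1 - r) = 2 * t' * (1 - r)"
    using assms(2-5) unfolding param_u_def by metis
  then show ?thesis using assms(1) by simp
qed

theorem theorem3p1:
  fixes q :: rat
  assumes "q \<noteq> 1" and "q \<noteq> - 1"
  shows "is_node (Phi q) (1, 0) \<and>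
    (\<forall>t. param_den t q \<noteq> 0 \<longrightarrow> (param_rho t q, param_u t q) \<in> affine_curve (Phi q)) \<and>
    (\<forall>r u. (r, u) \<in> affine_curve (Phi q) \<and> (r, u) \<noteq> (1, 0) \<and> \<not> (q = 0 \<and> u = r - 1) \<longrightarrow>
       (\<exists>!t. param_den t q \<noteq> 0 \<and> r = param_rho t q \<and> u = param_u t q))"
proof (intro conjI allI impI)
  show "is_node (Phi q) (1, 0)"
    by (rule is_node_Phi[OF assms(1)])
next
  fix t assume "param_den t q \<noteq> 0"
  then show "(param_rho t q, param_u t q) \<in> affine_curve (Phi q)"
    by (rule param_in_curve[OF assms(1)])
next
  fix r u
  assume P: "(r, u) \<in> affine_curve (Phi q) \<and> (r, u) \<noteq> (1, 0) \<and> \<not> (q = 0 \<and> u = r - 1)"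
  then have r: "r \<noteq> 1"
    using curve_point_on_vertical by blast
  with P obtain t where "param_den t q \<noteq> 0 \<and> r = param_rho t q \<and> u = param_u t q"
    using param_exists[OF assms] by blast
  then show "\<exists>!t. param_den t q \<noteq> 0 \<and> r = param_rho t q \<and> u = param_u t q"
    using param_unique[OF r] by (intro ex1I) blast+
qed

end
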